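(* Let $n\ge 1$, $q=2^n$, and let $\phi,\chi$ be quadratic forms over $\mathbb{F}_q$ in variables $x,y,z$ such that the pencil $\{\alpha\phi+\beta\chi : (\alpha:\beta)\in\mathrm{PG}(1,q)\}$ is a trivially intersecting pencil of non-singular conic translation ovals in $\mathrm{PG}(2,q)$. For each member $\alpha\phi+\beta\chi$ of the pencil let $S_{(\alpha:\beta)}=\{(x,y)\in\mathbb{F}_q^2 : \alpha\phi(x,y,1)+\beta\chi(x,y,1)=0\}$. Then the sets $S_{(\alpha:\beta)}$ form a spread of $\mathbb{F}_q^2\cong\mathbb{F}_2^{2n}$, the translation plane constructed from this spread is Desarguesian, and it is orthogoval to the translation plane constructed from the line spread.
   Context: Points of $\mathrm{PG}(2,q)$ are written $(x:y:z)$; the affine plane $\mathrm{AG}(2,q)$ is identified with the points $(x:y:1)$, i.e. with $\mathbb{F}_q^2$. An oval in $\mathrm{PG}(2,q)$ is a set of $q+1$ points no three collinear. For $q=2^n$, an oval $\mathcal{O}$ is a translation oval if $(x_0+x_1:y_0+y_1:1)\in\mathcal{O}$ whenever $(x_0:y_0:1),(x_1:y_1:1)\in\mathcal{O}$. Two translation ovals are trivially intersecting if they intersect only in $(0:0:1)$; a pencil of translation ovals is trivially intersecting if any two distinct members are. A spread of $\mathbb{F}_2^{2n}$ is a set of $n$-dimensional $\mathbb{F}_2$-subspaces pairwise intersecting only in $0$ (and covering the space); the translation plane constructed from a spread has point set $\mathbb{F}_2^{2n}$ and as lines all cosets of the spread members. The line spread is the set of $1$-dimensional $\mathbb{F}_q$-subspaces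 of $\mathbb{F}_q^2$; its translation plane is the Desarguesian $\mathrm{AG}(2,q)$. Two affine planes of the same order on the same point set are orthogoval if every line of one meets every line of the other in at most two points. *)

theory Defs
  imports "HOL-Analysis.Analysis" "HOL-Library.Z2"
begin

section \<open>Projective spaces and ovals\<close>

text \<open>
  For a field \<open>'a\<close> of order \<open>q\<close>, the points and lines of \<open>PG(m - 1, q)\<close> are the one- and
  two-dimensional subspaces of the coordinate space \<open>'a ^ 'm\<close> with \<open>m = CARD('m)\<close>.
\<close>

definition pg_points :: "('a::field ^ 'm) set set" where
  "pg_points = {P. vec.subspace P \<and> vec.dim P = 1}"

definition pg_lines :: "('a::field ^ 'm) set set" where
  "pg_lines = {l. vec.subspace l \<and> vec.dim l = 2}"

text \<open>The point \<open>(x : y : z)\<close> of the projective plane, for \<open>(x, y, z) \<noteq> 0\<close>.\<close>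

definition hom_point :: "'a::field \<Rightarrow> 'a \<Rightarrow> 'a \<Rightarrow> ('a ^ 3) set" where
  "hom_point x y z = vec.span {vector [x, y, z]}"

definition pg_collinear :: "('a::field ^ 3) set set \<Rightarrow> bool" where
  "pg_collinear A \<longleftrightarrow> (\<exists>l\<in>pg_lines. \<forall>P\<in>A. P \<subseteq> l)"

definition oval :: "('a::{field,finite} ^ 3) set set \<Rightarrow> bool" where
  "oval C \<longleftrightarrow> C \<subseteq> pg_points \<and> card C = CARD('a) + 1 \<and>
     (\<forall>P\<in>C. \<forall>Q\<in>C. \<forall>R\<in>C. P \<noteq> Q \<longrightarrow> P \<noteq> R \<longrightarrow> Q \<noteq> R \<longrightarrow> \<not> pg_collinear {P, Q, R})"

text \<open>Only used for fields of order \<open>2 ^ n\<close>.\<close>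

definition translation_oval :: "('a::{field,finite} ^ 3) set set \<Rightarrow> bool" where
  "translation_oval C \<longleftrightarrow> oval C \<and>
     (\<forall>x0 y0 x1 y1. hom_point x0 y0 1 \<in> C \<longrightarrow> hom_point x1 y1 1 \<in> C \<longrightarrow>
        hom_point (x0 + x1) (y0 + y1) 1 \<in> C)"

definition trivially_intersecting :: "('a::field ^ 3) set set \<Rightarrow> ('a ^ 3) set set \<Rightarrow> bool" where
  "trivially_intersecting C D \<longleftrightarrow> C \<inter> D = {hom_point 0 0 1}"


section \<open>Quadratic forms and conics\<close>

text \<open>
  A ternary quadratic form is represented by the function it induces. Over any field, the two-element
  field included, this function determines the six coefficients.
\<close>

definition quadratic_form :: "('a::field ^ 3 \<Rightarrow> 'a) \<Rightarrow> bool" where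
  "quadratic_form F \<longleftrightarrow> (\<exists>a b c d e f. \<forall>v. F v =
     a * (v$1)\<^sup>2 + b * (v$2)\<^sup>2 + c * (v$3)\<^sup>2 + d * v$1 * v$2 + e * v$1 * v$3 + f * v$2 * v$3)"

text \<open>
  A singular point is a zero of the form at which all its partial derivatives vanish, equivalently
  a zero in the radical of the polar form \<open>F (v + w) - F v - F w\<close>. For
  the finite (hence perfect) fields considered here, a form with a singular point over the
  algebraic closure already has one over the field itself.
\<close>

definition non_singular :: "('a::field ^ 3 \<Rightarrow> 'a) \<Rightarrow> bool" where
  "non_singular F \<longleftrightarrow> (\<forall>v. F v = 0 \<and> (\<forall>w. F (v + w) - F v - F w = 0) \<longrightarrow> v = 0)"

definition conic_of :: "('a::field ^ 3 \<Rightarrow> 'a) \<Rightarrow> ('a ^ 3) set set" where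
  "conic_of F = {P \<in> pg_points. \<forall>v\<in>P. F v = 0}"

definition pencil_member :: "('b \<Rightarrow> 'a::field) \<Rightarrow> ('b \<Rightarrow> 'a) \<Rightarrow> 'a \<Rightarrow> 'a \<Rightarrow> 'b \<Rightarrow> 'a" where
  "pencil_member \<phi> \<psi> \<alpha> \<beta> v = \<alpha> * \<phi> v + \<beta> * \<psi> v"

text \<open>
  The parameter \<open>(\<alpha> : \<beta>)\<close> in \<open>PG(1, q)\<close> is represented by the nonzero pairs \<open>(\<alpha>, \<beta>)\<close>;
  proportional pairs yield proportional forms, hence the same conic.
\<close>

definition pencil_conics :: "('a::field ^ 3 \<Rightarrow> 'a) \<Rightarrow> ('a ^ 3 \<Rightarrow> 'a) \<Rightarrow> ('a ^ 3) set set set" where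
  "pencil_conics \<phi> \<psi> = {conic_of (pencil_member \<phi> \<psi> \<alpha> \<beta>) | \<alpha> \<beta>. (\<alpha>, \<beta>) \<noteq> (0, 0)}"

definition trivially_intersecting_conic_pencil ::
    "('a::{field,finite} ^ 3 \<Rightarrow> 'a) \<Rightarrow> ('a ^ 3 \<Rightarrow> 'a) \<Rightarrow> bool" where
  "trivially_intersecting_conic_pencil \<phi> \<psi> \<longleftrightarrow>
     (\<forall>\<alpha> \<beta>. (\<alpha>, \<beta>) \<noteq> (0, 0) \<longrightarrow> non_singular (pencil_member \<phi> \<psi> \<alpha> \<beta>)) \<and>
     (\<forall>C\<in>pencil_conics \<phi> \<psi>. translation_oval C) \<and>
     (\<forall>C\<in>pencil_conics \<phi> \<psi>. \<forall>D\<in>pencil_conics \<phi> \<psi>. C \<noteq> D \<longrightarrow> trivially_intersecting C D)"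

definition affine_part :: "('a::field ^ 3 \<Rightarrow> 'a) \<Rightarrow> ('a ^ 2) set" where
  "affine_part F = {v. F (vector [v$1, v$2, 1]) = 0}"

definition affine_parts :: "('a::field ^ 3 \<Rightarrow> 'a) \<Rightarrow> ('a ^ 3 \<Rightarrow> 'a) \<Rightarrow> ('a ^ 2) set set" where
  "affine_parts \<phi> \<psi> = {affine_part (pencil_member \<phi> \<psi> \<alpha> \<beta>) | \<alpha> \<beta>. (\<alpha>, \<beta>) \<noteq> (0, 0)}"


section \<open>Spreads and translation planes\<close>

text \<open>
  An additive group of exponent two is a vector space over the two-element field \<open>bit\<close> in exactly
  one way.
\<close>

definition f2_scale :: "bit \<Rightarrow> 'v::ab_group_add \<Rightarrow> 'v" where
  "f2_scale c v = (if c = 0 then 0 else v)"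

definition is_spread :: "nat \<Rightarrow> 'v::ab_group_add set set \<Rightarrow> bool" where
  "is_spread n \<S> \<longleftrightarrow>
     vector_space (f2_scale :: bit \<Rightarrow> 'v \<Rightarrow> 'v) \<and>
     vector_space.dim f2_scale (UNIV :: 'v set) = 2 * n \<and>
     (\<forall>S\<in>\<S>. module.subspace f2_scale S \<and> vector_space.dim f2_scale S = n) \<and>
     (\<forall>S\<in>\<S>. \<forall>T\<in>\<S>. S \<noteq> T \<longrightarrow> S \<inter> T = {0}) \<and>
     \<Union>\<S> = UNIV"

definition translation_plane :: "'v::ab_group_add set set \<Rightarrow> 'v set set" where
  "translation_plane \<S> = {(+) v ` S | v S. S \<in> \<S>}"

definition line_spread :: "('a::field ^ 2) set set" where
  "line_spread = pg_points"


section \<open>Affine planes\<close>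

text \<open>An affine plane is given by its set of points and its set of lines, lines being sets of points.\<close>

definition affine_plane :: "nat \<Rightarrow> 'p set \<Rightarrow> 'p set set \<Rightarrow> bool" where
  "affine_plane N X L \<longleftrightarrow>
     2 \<le> N \<and>
     (\<forall>l\<in>L. l \<subseteq> X \<and> card l = N) \<and>
     (\<forall>p\<in>X. \<forall>r\<in>X. p \<noteq> r \<longrightarrow> (\<exists>!l. l \<in> L \<and> p \<in> l \<and> r \<in> l)) \<and>
     (\<forall>l\<in>L. \<forall>p\<in>X - l. \<exists>!m. m \<in> L \<and> p \<in> m \<and> m \<inter> l = {}) \<and>
     (\<exists>p\<in>X. \<exists>r\<in>X. \<exists>s\<in>X. p \<noteq> r \<and> p \<noteq> s \<and> r \<noteq> s \<and> \<not> (\<exists>l\<in>L. p \<in> l \<and> r \<in> l \<and> s \<in> l))"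

definition plane_isomorphic :: "'p set \<Rightarrow> 'p set set \<Rightarrow> 'r set \<Rightarrow> 'r set set \<Rightarrow> bool" where
  "plane_isomorphic X L Y M \<longleftrightarrow> (\<exists>f. bij_betw f X Y \<and> (\<lambda>l. f ` l) ` L = M)"

text \<open>
  The Desarguesian plane on \<open>q\<^sup>2\<close> points is \<open>AG(2, q)\<close>, whose lines are all cosets of the
  one-dimensional subspaces of \<open>'a ^ 2\<close>.
\<close>

definition desarguesian :: "('a::field ^ 2) set set \<Rightarrow> bool" where
  "desarguesian L \<longleftrightarrow>
     plane_isomorphic UNIV L UNIV (translation_plane (line_spread :: ('a ^ 2) set set))"

definition orthogoval :: "'p set \<Rightarrow> 'p set set \<Rightarrow> 'p set set \<Rightarrow> bool" where
  "orthogoval X L M \<longleftrightarrow>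
     (\<exists>N. affine_plane N X L \<and> affine_plane N X M) \<and> (\<forall>l\<in>L. \<forall>m\<in>M. card (l \<inter> m) \<le> 2)"

end

theory Submission
  imports Defs "HOL-Number_Theory.Residues"
begin

text \<open>
  Put \<open>g v = (\<phi>(v, 1), \<psi>(v, 1))\<close> for \<open>v\<close> in \<open>\<bbbF>\<^sub>q\<^sup>2\<close>. The affine part of the member
  \<open>\<alpha>\<phi> + \<beta>\<psi>\<close> is the preimage under \<open>g\<close> of the line \<open>\<alpha>X + \<beta>Y = 0\<close>, so everything but
  orthogovality follows once \<open>g\<close> is an additive bijection. Two members meet only in \<open>(0 : 0 : 1)\<close>,
  so the kernel of \<open>g\<close> is trivial and the forms have no \<open>z\<^sup>2\<close> term; additivity then amounts to
  the vanishing of the coefficient \<open>d\<close> of \<open>xy\<close>. If \<open>v\<close>, \<open>w\<close> are in the affine part \<open>S\<close> of an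
  oval of the pencil then so is \<open>v + w\<close>, which gives \<open>d det(v, w) = 0\<close>; hence \<open>d \<noteq> 0\<close> would put all of
  \<open>S\<close> on one line, although \<open>S\<close> has at least \<open>q - 1\<close> points and a line contains at most two of
  them. This settles \<open>q \<ge> 4\<close>. For \<open>q = 2\<close> one counts the zeros of the three members: each nonzero
  vector lies on exactly one of them, none contains two, so each contains exactly one,
  and again \<open>d = \<phi>(1, 1, 1) + \<phi>(1, 0, 1) + \<phi>(0, 1, 1) = 0\<close>.

  Orthogovality holds because a line meets an oval in at most two points.
\<close>

section \<open>Partitions of groups into subgroups\<close>

text \<open>The frame shared by the line spread and by its preimage under \<open>g\<close>, with
  \<open>N = q\<close>. Working with subgroups of order \<open>N\<close> in a group of order
  \<open>N * N\<close> reduces both the plane axioms and the spread property to counting.\<close>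

locale group_partition =
  fixes N :: nat and \<S> :: "'v::{ab_group_add,finite} set set"
  assumes two_le: "2 \<le> N" and card_univ: "CARD('v) = N * N"
    and zero_mem: "A \<in> \<S> \<Longrightarrow> 0 \<in> A"
    and diff_mem: "A \<in> \<S> \<Longrightarrow> x \<in> A \<Longrightarrow> y \<in> A \<Longrightarrow> x - y \<in> A"
    and card_member: "A \<in> \<S> \<Longrightarrow> card A = N"
    and inter_member: "A \<in> \<S> \<Longrightarrow> B \<in> \<S> \<Longrightarrow> A \<noteq> B \<Longrightarrow> A \<inter> B = {0}"
    and cover: "\<Union>\<S> = UNIV"
begin

lemma uminus_mem: "A \<in> \<S> \<Longrightarrow> x \<in> A \<Longrightarrow> - x \<in> A"
  using diff_mem[of A 0 x] zero_mem[of A] by simp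

lemma add_mem: "A \<in> \<S> \<Longrightarrow> x \<in> A \<Longrightarrow> y \<in> A \<Longrightarrow> x + y \<in> A"
  using diff_mem[of A x "- y"] uminus_mem[of A y] by simp

lemma member_eqI:
  assumes "A \<in> \<S>" "B \<in> \<S>" "x \<in> A" "x \<in> B" "x \<noteq> 0"
  shows "A = B"
proof (rule ccontr)
  assume "A \<noteq> B"
  then have "x \<in> {0}"
    using inter_member[OF assms(1,2)] assms(3,4) by blast
  then show False
    using assms(5) by simp
qed

lemma obtain_member:
  obtains A where "A \<in> \<S>" "x \<in> A"
proof -
  have "x \<in> \<Union>\<S>"
    by (simp add: cover)
  then show ?thesis
    using that by blast
qed

text \<open>Addition on \<open>A \<times> B\<close> is injective because the two members meet only
  in 0, and the \<open>N * N\<close> sums then exhaust the group.\<close>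

lemma sum_of_members:
  assumes A: "A \<in> \<S>" and B: "B \<in> \<S>" and "A \<noteq> B"
  obtains a b where "a \<in> A" "b \<in> B" "v = a + b"
proof -
  let ?f = "\<lambda>(a, b). a + b :: 'v"
  have "inj_on ?f (A \<times> B)"
  proof (rule inj_onI, clarsimp)
    fix a b a' b'
    assume ab: "a \<in> A" "b \<in> B" "a' \<in> A" "b' \<in> B" "a + b = a' + b'"
    then have eq: "a - a' = b' - b"
      by (simp add: algebra_simps)
    have "a - a' \<in> A \<inter> B"
      using diff_mem[OF A, of a a'] diff_mem[OF B, of b' b] ab eq by simp
    then have "a - a' = 0"
      using inter_member[OF assms] by simp
    then show "a = a' \<and> b = b'"
      using eq by simp
  qed
  then have "card (?f ` (A \<times> B)) = CARD('v)"
    by (simp add: card_image card_cartesian_product card_member A B card_univ)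
  then have "?f ` (A \<times> B) = UNIV"
    by (intro card_subset_eq) auto
  then have "v \<in> ?f ` (A \<times> B)"
    by simp
  then show ?thesis
    using that by auto
qed

lemma translation_plane_iff:
  "l \<in> translation_plane \<S> \<longleftrightarrow> (\<exists>w. \<exists>A\<in>\<S>. l = {x. x - w \<in> A})"
proof -
  have "(+) w ` A = {x. x - w \<in> A}" for w and A :: "'v set"
    by (auto simp: image_iff) (metis add_diff_cancel_left' diff_add_cancel add.commute)
  then show ?thesis
    unfolding translation_plane_def by auto
qed

lemma coset_cong:
  assumes "A \<in> \<S>" "w - p \<in> A"
  shows "{x. x - w \<in> A} = {x. x - p \<in> A}"
proof -
  have "x - w \<in> A \<longleftrightarrow> x - p \<in> A" for x
    using add_mem[OF assms(1) _ assms(2), of "x - w"] diff_mem[OF assms(1) _ assms(2), of "x - p"]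
    by auto
  then show ?thesis
    by simp
qed

text \<open>A coset can be recentred at any of its points, so a line through \<open>p\<close> is
  determined by a member alone.\<close>

lemma lineE:
  assumes "l \<in> translation_plane \<S>" "p \<in> l"
  obtains A where "A \<in> \<S>" "l = {x. x - p \<in> A}"
proof -
  obtain w A where A: "A \<in> \<S>" and l: "l = {x. x - w \<in> A}"
    using assms(1) unfolding translation_plane_iff by blast
  have "w - p \<in> A"
    using uminus_mem[OF A, of "p - w"] assms(2) l by simp
  then show ?thesis
    using coset_cong[OF A] that[OF A] l by simp
qed

text \<open>Provides the triangle 0, \<open>a\<close>, \<open>b\<close> of the affine plane:
  \<open>N \<ge> 2\<close> gives every member a nonzero element, and \<open>N < N * N\<close>
  prevents one member from covering the group.\<close>

lemma two_members:
  obtains A B a b where "A \<in> \<S>" "B \<in> \<S>" "A \<noteq> B" "a \<in> A" "b \<in> B" "a \<noteq> 0" "b \<noteq> 0"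
proof -
  have nz: "\<exists>a\<in>A. a \<noteq> 0" if "A \<in> \<S>" for A
  proof (rule ccontr)
    assume "\<not> ?thesis"
    then have "A \<subseteq> {0}"
      by auto
    then have "card A \<le> 1"
      using card_mono[of "{0}" A] by simp
    then show False
      using card_member[OF that] two_le by simp
  qed
  obtain A where A: "A \<in> \<S>"
    using obtain_member by blast
  have "A \<noteq> UNIV"
    using card_member[OF A] card_univ two_le by auto
  then obtain x where x: "x \<notin> A"
    by blast
  obtain B where B: "B \<in> \<S>" "x \<in> B"
    using obtain_member by blast
  show ?thesis
    using nz[OF A] nz[OF B(1)] that[OF A B(1)] x B(2) by blast
qed

text \<open>The line joining \<open>p\<close> and \<open>r\<close> is a coset of the unique member
  containing \<open>r - p\<close>. Parallels are cosets of the same member, since cosets of distinct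
  members always meet by \<open>sum_of_members\<close>.\<close>

lemma affine_plane: "affine_plane N UNIV (translation_plane \<S>)"
  unfolding affine_plane_def
proof (intro conjI ballI impI)
  show "2 \<le> N"
    by (rule two_le)
next
  fix l assume "l \<in> translation_plane \<S>"
  then obtain v A where "A \<in> \<S>" "l = (+) v ` A"
    unfolding translation_plane_def by blast
  then show "l \<subseteq> UNIV" "card l = N"
    using card_member by (auto simp: card_image)
next
  fix p r :: 'v
  assume "p \<noteq> r"
  obtain A where A: "A \<in> \<S>" "r - p \<in> A"
    using obtain_member by blast
  show "\<exists>!l. l \<in> translation_plane \<S> \<and> p \<in> l \<and> r \<in> l"
  proof (intro ex1I conjI)
    show "{x. x - p \<in> A} \<in> translation_plane \<S>"
      using A translation_plane_iff by blast
    show "p \<in> {x. x - p \<in> A}" "r \<in> {x. x - p \<in> A}"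
      using A zero_mem by auto
    fix l assume l: "l \<in> translation_plane \<S> \<and> p \<in> l \<and> r \<in> l"
    then obtain B where B: "B \<in> \<S>" "l = {x. x - p \<in> B}"
      using lineE by blast
    then have "B = A"
      using member_eqI[of B A "r - p"] l A \<open>p \<noteq> r\<close> by simp
    then show "l = {x. x - p \<in> A}"
      using B by simp
  qed
next
  fix l p
  assume "l \<in> translation_plane \<S>" and p: "p \<in> UNIV - l"
  then obtain w A where A: "A \<in> \<S>" and l: "l = {x. x - w \<in> A}"
    unfolding translation_plane_iff by blast
  show "\<exists>!m. m \<in> translation_plane \<S> \<and> p \<in> m \<and> m \<inter> l = {}"
  proof (intro ex1I conjI)
    show "{x. x - p \<in> A} \<in> translation_plane \<S>"
      using A translation_plane_iff by blast
    show "p \<in> {x. x - p \<in> A}"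
      using A zero_mem by auto
    have "p - w \<in> A" if "x - p \<in> A" "x - w \<in> A" for x
      using diff_mem[OF A that(2,1)] by simp
    then show "{x. x - p \<in> A} \<inter> l = {}"
      using p l by auto
    fix m assume m: "m \<in> translation_plane \<S> \<and> p \<in> m \<and> m \<inter> l = {}"
    then obtain B where B: "B \<in> \<S>" "m = {x. x - p \<in> B}"
      using lineE by blast
    have "A = B"
    proof (rule ccontr)
      assume "A \<noteq> B"
      then obtain a b where ab: "a \<in> A" "b \<in> B" "p - w = a + b"
        using sum_of_members[OF A B(1)] by metis
      \<comment> \<open>The point \<open>p - b\<close>, which equals \<open>w + a\<close>, lies on
        both lines.\<close>
      have "p - b - w = a" "p - b - p = - b"
        using ab(3) by (simp_all add: algebra_simps)
      then have "p - b \<in> m \<inter> l"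
        using ab B l uminus_mem by simp
      then show False
        using m by blast
    qed
    then show "m = {x. x - p \<in> A}"
      using B by simp
  qed
next
  obtain A B a b where AB: "A \<in> \<S>" "B \<in> \<S>" "A \<noteq> B" "a \<in> A" "b \<in> B" "a \<noteq> 0" "b \<noteq> 0"
    using two_members .
  have "a \<noteq> b"
    using member_eqI AB by blast
  moreover have False
    if l: "l \<in> translation_plane \<S>" "0 \<in> l" "a \<in> l" "b \<in> l" for l
  proof -
    obtain D where "D \<in> \<S>" "l = {x. x - 0 \<in> D}"
      using lineE[OF l(1,2)] .
    then show False
      using l AB member_eqI[of A D a] member_eqI[of B D b] by simp
  qed
  ultimately show "\<exists>p\<in>UNIV. \<exists>r\<in>UNIV. \<exists>s\<in>UNIV. p \<noteq> r \<and> p \<noteq> s \<and> r \<noteq> s \<and>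
      \<not> (\<exists>l\<in>translation_plane \<S>. p \<in> l \<and> r \<in> l \<and> s \<in> l)"
    using AB(6,7) by (metis UNIV_I)
qed

end

section \<open>Exponent two and dimension over the two-element field\<close>

lemma vector_space_f2_scale:
  assumes "\<And>x :: 'v::ab_group_add. x + x = 0"
  shows "vector_space (f2_scale :: bit \<Rightarrow> 'v \<Rightarrow> 'v)"
proof
  fix a b :: bit and x y :: 'v
  show "f2_scale a (x + y) = f2_scale a x + f2_scale a y"
    by (simp add: f2_scale_def)
  show "f2_scale (a + b) x = f2_scale a x + f2_scale b x"
    using assms by (cases a; cases b) (simp_all add: f2_scale_def)
  show "f2_scale a (f2_scale b x) = f2_scale (a * b) x"
    by (simp add: f2_scale_def)
  show "f2_scale 1 x = x"
    by (simp add: f2_scale_def)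
qed

text \<open>Each further basis vector \<open>b\<close> doubles the span, which becomes the disjoint
  union of the old span and its translate by \<open>b\<close>. Dimensions can thus be read off from
  cardinalities.\<close>

lemma card_eq_two_power_dim:
  fixes V :: "'v::{ab_group_add,finite} set"
  assumes two: "\<And>x :: 'v. x + x = 0" and V: "module.subspace f2_scale V"
  shows "card V = 2 ^ vector_space.dim f2_scale V"
proof -
  interpret vector_space "f2_scale :: bit \<Rightarrow> 'v \<Rightarrow> 'v"
    by (rule vector_space_f2_scale[OF two])
  have span_card: "card (span B) = 2 ^ card B" if "finite B" "independent B" for B
    using that
  proof (induction B rule: finite_induct)
    case empty
    then show ?case by simp
  next
    case (insert b B)
    then have ind: "independent B" and b: "b \<notin> span B"
      by (auto simp: independent_insert)
    have "x \<in> span (insert b B) \<longleftrightarrow> x \<in> span B \<union> (+) b ` span B" for x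
    proof -
      \<comment> \<open>The only scalars are 0 and 1, so \<open>span_breakdown_eq\<close> leaves two
        cases.\<close>
      have "x \<in> span (insert b B) \<longleftrightarrow> x \<in> span B \<or> x - b \<in> span B"
        unfolding span_breakdown_eq
        by (auto simp: f2_scale_def split: if_splits
            intro: exI[of _ "0::bit"] exI[of _ "1::bit"])
      also have "x - b \<in> span B \<longleftrightarrow> x \<in> (+) b ` span B"
        by (force simp: image_iff)
      finally show ?thesis by simp
    qed
    then have "span (insert b B) = span B \<union> (+) b ` span B"
      by blast
    moreover have "span B \<inter> (+) b ` span B = {}"
    proof -
      have False if "y \<in> span B" "b + y \<in> span B" for y
        using span_diff[OF that(2,1)] b by simp
      then show ?thesis by blast
    qed
    ultimately have "card (span (insert b B)) = card (span B) + card ((+) b ` span B)"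
      by (simp add: card_Un_disjoint)
    then show ?case
      using insert ind by (simp add: card_image)
  qed
  obtain B where B: "B \<subseteq> V" "independent B" "V \<subseteq> span B" "card B = dim V"
    using basis_exists by blast
  have "span B = V"
    using B V span_minimal by blast
  then show ?thesis
    using span_card[of B] B by simp
qed

text \<open>A subgroup is already a subspace over \<open>bit\<close>; both dimensions then follow by
  comparing powers of two.\<close>

lemma (in group_partition) is_spread:
  assumes two: "\<And>x :: 'v. x + x = 0" and N: "N = 2 ^ n"
  shows "is_spread n \<S>"
proof -
  interpret vector_space "f2_scale :: bit \<Rightarrow> 'v \<Rightarrow> 'v"
    by (rule vector_space_f2_scale[OF two])
  have "2 ^ dim (UNIV :: 'v set) = (2 :: nat) ^ (2 * n)"
    using card_eq_two_power_dim[OF two subspace_UNIV] card_univ N by (simp add: power_add mult_2)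
  then have "dim (UNIV :: 'v set) = 2 * n"
    by simp
  moreover have "subspace A \<and> dim A = n" if A: "A \<in> \<S>" for A
  proof -
    have "subspace A"
      unfolding subspace_def using zero_mem[OF A] add_mem[OF A] by (simp add: f2_scale_def)
    moreover have "2 ^ dim A = (2 :: nat) ^ n"
      using card_eq_two_power_dim[OF two \<open>subspace A\<close>] card_member[OF A] N by simp
    ultimately show ?thesis
      by simp
  qed
  ultimately show ?thesis
    unfolding is_spread_def using vector_space_axioms inter_member cover by blast
qed

text \<open>Serves to pull the line spread back along \<open>g\<close> to the affine parts of the
  pencil.\<close>

lemma (in group_partition) group_partition_vimage:
  fixes g :: "'v \<Rightarrow> 'v"
  assumes add: "\<And>x y. g (x + y) = g x + g y" and "bij g"
  shows "group_partition N ((\<lambda>A. g -` A) ` \<S>)"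
proof -
  have g0: "g 0 = 0"
    using add[of 0 0] by simp
  have diff: "g (x - y) = g x - g y" for x y
    using add[of "x - y" y] by (simp add: algebra_simps)
  have g0_iff: "g x = 0 \<longleftrightarrow> x = 0" for x
    using \<open>bij g\<close> g0 by (metis bij_def injD)
  show ?thesis
  proof
    show "2 \<le> N" "CARD('v) = N * N"
      by (rule two_le card_univ)+
    show "\<Union>((\<lambda>A. g -` A) ` \<S>) = UNIV"
      using cover by (simp flip: vimage_Union)
    fix A' assume "A' \<in> (\<lambda>A. g -` A) ` \<S>"
    then obtain A where A: "A \<in> \<S>" "A' = g -` A"
      by blast
    show "0 \<in> A'"
      using A zero_mem g0 by simp
    show "card A' = N"
      using \<open>bij g\<close> A by (simp add: card_vimage_inj bij_def card_member)
    show "x - y \<in> A'" if "x \<in> A'" "y \<in> A'" for x y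
      using that A diff_mem diff by simp
    fix B' assume "B' \<in> (\<lambda>A. g -` A) ` \<S>" and "A' \<noteq> B'"
    then obtain B where B: "B \<in> \<S>" "B' = g -` B" "A \<noteq> B"
      using A by blast
    then have "A' \<inter> B' = g -` {0}"
      using A inter_member[of A B] by blast
    then show "A' \<inter> B' = {0}"
      using g0_iff by auto
  qed
qed

section \<open>Lines, ovals and quadratic forms\<close>

lemma pg_pointE:
  assumes "P \<in> pg_points"
  obtains u where "u \<noteq> 0" "P = vec.span {u}"
proof -
  from assms have P: "vec.subspace P" "vec.dim P = 1"
    by (auto simp: pg_points_def)
  obtain B where B: "B \<subseteq> P" "vec.independent B" "P \<subseteq> vec.span B" "card B = vec.dim P"
    using vec.basis_exists by blast
  then obtain u where "B = {u}"
    using P card_1_singletonE by metis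
  then show ?thesis
    using B P that vec.span_minimal[of B P] by auto
qed

lemma span_singleton_in_pg_points: "u \<noteq> 0 \<Longrightarrow> vec.span {u} \<in> pg_points"
  by (simp add: pg_points_def)

lemma span_pair_in_pg_lines:
  assumes "w \<noteq> 0" "u \<notin> vec.span {w}"
  shows "vec.span {u, w} \<in> pg_lines"
proof -
  have "u \<noteq> w"
    using assms vec.span_base by blast
  moreover have "vec.independent {u, w}"
    using assms by (auto simp: vec.independent_insert)
  ultimately show ?thesis
    by (simp add: pg_lines_def vec.dim_eq_card_independent)
qed

text \<open>Describes a line through the origin by an equation whose coefficients range over the
  parameter pairs of the pencil. The line spanned by \<open>u\<close> is the zero set of the
  determinant of \<open>w\<close> and \<open>u\<close>.\<close>

lemma line_spread_eq:
  "line_spread = {{w :: 'a::field ^ 2. \<alpha> * w$1 + \<beta> * w$2 = 0} | \<alpha> \<beta>. (\<alpha>, \<beta>) \<noteq> (0, 0)}"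
proof -
  have span_eq: "vec.span {u} = {w. u$2 * w$1 + (- u$1) * w$2 = 0}" if "u \<noteq> 0" for u :: "'a ^ 2"
  proof -
    have "w \<in> vec.span {u} \<longleftrightarrow> u$2 * w$1 + (- u$1) * w$2 = 0" for w
    proof
      assume "w \<in> vec.span {u}"
      then show "u$2 * w$1 + (- u$1) * w$2 = 0"
        by (auto simp: vec.span_singleton)
    next
      assume eq: "u$2 * w$1 + (- u$1) * w$2 = 0"
      \<comment> \<open>The scalar is found from whichever coordinate of \<open>u\<close> is
        nonzero.\<close>
      have "w = (if u$1 = 0 then w$2 / u$2 else w$1 / u$1) *s u"
        using eq that by (auto simp: vec_eq_iff forall_2 field_simps)
      then show "w \<in> vec.span {u}"
        unfolding vec.span_singleton by blast
    qed
    then show ?thesis by blast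
  qed
  show ?thesis
  proof (intro equalityI subsetI)
    fix P :: "('a ^ 2) set" assume "P \<in> line_spread"
    then obtain u where u: "u \<noteq> 0" "P = vec.span {u}"
      unfolding line_spread_def using pg_pointE by blast
    then have "(u$2, - u$1) \<noteq> (0, 0)"
      by (auto simp: vec_eq_iff forall_2)
    then show "P \<in> {{w. \<alpha> * w$1 + \<beta> * w$2 = 0} | \<alpha> \<beta>. (\<alpha>, \<beta>) \<noteq> (0, 0)}"
      using span_eq u by blast
  next
    fix P :: "('a ^ 2) set" assume "P \<in> {{w. \<alpha> * w$1 + \<beta> * w$2 = 0} | \<alpha> \<beta>. (\<alpha>, \<beta>) \<noteq> (0, 0)}"
    then obtain \<alpha> \<beta> where ab: "(\<alpha>, \<beta>) \<noteq> (0, 0)" "P = {w. \<alpha> * w$1 + \<beta> * w$2 = 0}"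
      by blast
    define u :: "'a ^ 2" where "u = vector [- \<beta>, \<alpha>]"
    have "u \<noteq> 0"
      using ab by (auto simp: u_def vec_eq_iff forall_2)
    moreover have "P = vec.span {u}"
      using span_eq[OF \<open>u \<noteq> 0\<close>] ab by (simp add: u_def)
    ultimately show "P \<in> line_spread"
      by (simp add: line_spread_def span_singleton_in_pg_points)
  qed
qed

lemma card_pg_point:
  assumes "P \<in> pg_points"
  shows "card (P :: ('a::{field,finite} ^ 'm) set) = CARD('a)"
proof -
  obtain u where u: "u \<noteq> 0" "P = vec.span {u}"
    using assms by (rule pg_pointE)
  have "inj (\<lambda>k. k *s u)"
    using u by (auto intro: injI)
  then show ?thesis
    by (simp add: u vec.span_singleton card_image)
qed

lemma oval_line_card:
  assumes "oval C" "l \<in> pg_lines"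
  shows "card {P \<in> C. P \<subseteq> l} \<le> 2"
proof (rule ccontr)
  assume "\<not> ?thesis"
  then have "3 \<le> card {P \<in> C. P \<subseteq> l}"
    by simp
  then obtain T where "T \<subseteq> {P \<in> C. P \<subseteq> l}" "card T = 3"
    by (rule obtain_subset_with_card_n)
  moreover from this obtain P Q R where "T = {P, Q, R}" "P \<noteq> Q" "P \<noteq> R" "Q \<noteq> R"
    unfolding card_3_iff by blast
  ultimately have PQR: "{P, Q, R} \<subseteq> {P \<in> C. P \<subseteq> l}" "P \<noteq> Q" "P \<noteq> R" "Q \<noteq> R"
    by simp_all
  have "pg_collinear {P, Q, R}"
    unfolding pg_collinear_def by (rule bexI[OF _ assms(2)]) (use PQR in blast)
  moreover have "P \<in> C" "Q \<in> C" "R \<in> C"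
    using PQR by simp_all
  ultimately show False
    using assms(1) PQR(2-4) unfolding oval_def by blast
qed

lemma inj_hom_point_affine: "inj (\<lambda>v :: 'a::field ^ 2. hom_point (v$1) (v$2) 1)"
proof (rule injI)
  fix v w :: "'a ^ 2"
  assume "hom_point (v$1) (v$2) 1 = hom_point (w$1) (w$2) 1"
  then have "vector [v$1, v$2, 1] \<in> vec.span {vector [w$1, w$2, 1] :: 'a ^ 3}"
    unfolding hom_point_def using vec.span_base by blast
  then obtain k where "vector [v$1, v$2, 1] = k *s (vector [w$1, w$2, 1] :: 'a ^ 3)"
    by (auto simp: vec.span_singleton)
  then show "v = w"
    by (auto simp: vec_eq_iff forall_3 forall_2)
qed

section \<open>Quadratic forms and the affine parts of their conics\<close>

lemma quadratic_form_scale: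
  assumes "quadratic_form F"
  shows "F (k *s v) = k\<^sup>2 * F v"
proof -
  obtain a b c d e f where F: "\<And>v. F v =
      a * (v$1)\<^sup>2 + b * (v$2)\<^sup>2 + c * (v$3)\<^sup>2 + d * v$1 * v$2 + e * v$1 * v$3 + f * v$2 * v$3"
    using assms unfolding quadratic_form_def by blast
  show ?thesis
    by (simp add: F algebra_simps power2_eq_square)
qed

text \<open>Homogeneity spreads the vanishing at one representative to the whole point;
  \<open>z \<noteq> 0\<close> guarantees that the representative is nonzero.\<close>

lemma hom_point_in_conic_iff:
  assumes "quadratic_form F" "z \<noteq> 0"
  shows "hom_point x y z \<in> conic_of F \<longleftrightarrow> F (vector [x, y, z]) = 0"
proof -
  have "vector [x, y, z] \<noteq> (0 :: 'a ^ 3)"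
    using assms(2) by (auto simp: vec_eq_iff forall_3)
  then have "hom_point x y z \<in> pg_points"
    by (simp add: hom_point_def span_singleton_in_pg_points)
  moreover have "(\<forall>v\<in>hom_point x y z. F v = 0) \<longleftrightarrow> F (vector [x, y, z]) = 0"
  proof
    assume "\<forall>v\<in>hom_point x y z. F v = 0"
    then show "F (vector [x, y, z]) = 0"
      by (simp add: hom_point_def vec.span_base)
  next
    assume "F (vector [x, y, z]) = 0"
    then show "\<forall>v\<in>hom_point x y z. F v = 0"
      by (simp add: hom_point_def vec.span_singleton quadratic_form_scale[OF assms(1)])
  qed
  ultimately show ?thesis
    by (simp add: conic_of_def)
qed

lemma affine_part_iff:
  assumes "quadratic_form F"
  shows "v \<in> affine_part F \<longleftrightarrow> hom_point (v$1) (v$2) 1 \<in> conic_of F"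
  by (simp add: affine_part_def hom_point_in_conic_iff[OF assms])

text \<open>Homogenising sends the affine line injectively into the projective line spanned by
  \<open>(p, 1)\<close> and \<open>(d, 0)\<close>, which contains at most two points of the
  oval.\<close>

lemma card_affine_part_line:
  assumes F: "quadratic_form F" and "oval (conic_of F)" and "d \<noteq> 0"
  shows "card (affine_part F \<inter> range (\<lambda>t. p + t *s d)) \<le> 2"
proof -
  define u :: "'a ^ 3" where "u = vector [p$1, p$2, 1]"
  define w :: "'a ^ 3" where "w = vector [d$1, d$2, 0]"
  define l where "l = vec.span {u, w}"
  have "w \<noteq> 0"
    using \<open>d \<noteq> 0\<close> by (auto simp: w_def vec_eq_iff forall_3 forall_2)
  moreover have "u \<notin> vec.span {w}"
    by (auto simp: u_def w_def vec.span_singleton vec_eq_iff forall_3)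
  ultimately have l: "l \<in> pg_lines"
    unfolding l_def by (rule span_pair_in_pg_lines)
  have sub: "hom_point (v$1) (v$2) 1 \<subseteq> l" if "v \<in> range (\<lambda>t. p + t *s d)" for v
  proof -
    from that obtain t where "v = p + t *s d"
      by blast
    then have "vector [v$1, v$2, 1] = u + t *s w"
      by (auto simp: u_def w_def vec_eq_iff forall_3)
    also have "\<dots> \<in> l"
      unfolding l_def by (intro vec.span_add vec.span_scale vec.span_base) auto
    finally show ?thesis
      unfolding hom_point_def l_def by (intro vec.span_minimal) auto
  qed
  have "card (affine_part F \<inter> range (\<lambda>t. p + t *s d)) \<le> card {P \<in> conic_of F. P \<subseteq> l}"
  proof (rule card_inj_on_le)
    show "inj_on (\<lambda>v. hom_point (v$1) (v$2) 1) (affine_part F \<inter> range (\<lambda>t. p + t *s d))"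
      using inj_hom_point_affine by (rule inj_on_subset) simp
    show "(\<lambda>v. hom_point (v$1) (v$2) 1) ` (affine_part F \<inter> range (\<lambda>t. p + t *s d))
        \<subseteq> {P \<in> conic_of F. P \<subseteq> l}"
      using sub affine_part_iff[OF F] by blast
  qed simp
  also have "\<dots> \<le> 2"
    using assms(2) l by (rule oval_line_card)
  finally show ?thesis .
qed

lemma card_affine_part_le:
  assumes F: "quadratic_form F" and "oval (conic_of F)"
  shows "card (affine_part (F :: 'a::{field,finite} ^ 3 \<Rightarrow> 'a)) \<le> CARD('a) + 1"
proof -
  have "card (affine_part F) \<le> card (conic_of F)"
    using affine_part_iff[OF F] inj_on_subset[OF inj_hom_point_affine, of "affine_part F"]
    by (intro card_inj_on_le[of "\<lambda>v. hom_point (v$1) (v$2) 1"]) auto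
  then show ?thesis
    using assms(2) by (simp add: oval_def)
qed

text \<open>Of the \<open>q + 1\<close> points of the oval at most two lie on the line at
  infinity.\<close>

lemma card_affine_part_ge:
  assumes F: "quadratic_form F" and "oval (conic_of F)"
  shows "CARD('a) \<le> card (affine_part (F :: 'a::{field,finite} ^ 3 \<Rightarrow> 'a)) + 1"
proof -
  \<comment> \<open>\<open>l\<close> is the line at infinity, where the third coordinate
    vanishes.\<close>
  define l :: "('a ^ 3) set" where "l = vec.span {vector [1, 0, 0], vector [0, 1, 0]}"
  have "l \<in> pg_lines"
    unfolding l_def
    by (rule span_pair_in_pg_lines) (auto simp: vec.span_singleton vec_eq_iff forall_3)
  have cov: "P \<in> (\<lambda>v. hom_point (v$1) (v$2) 1) ` affine_part F \<union> {P \<in> conic_of F. P \<subseteq> l}"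
    if P: "P \<in> conic_of F" for P
  proof -
    obtain u where u: "u \<noteq> 0" "P = vec.span {u}"
      using P pg_pointE unfolding conic_of_def by blast
    show ?thesis
    proof (cases "u$3 = 0")
      case True
      then have "u = u$1 *s vector [1, 0, 0] + u$2 *s vector [0, 1, 0]"
        by (simp add: vec_eq_iff forall_3)
      also have "\<dots> \<in> l"
        unfolding l_def by (intro vec.span_add vec.span_scale vec.span_base) auto
      finally have "P \<subseteq> l"
        unfolding u l_def by (intro vec.span_minimal) auto
      then show ?thesis
        using P by blast
    next
      case False
      define v :: "'a ^ 2" where "v = vector [u$1 / u$3, u$2 / u$3]"
      define w :: "'a ^ 3" where "w = vector [v$1, v$2, 1]"
      have "u = u$3 *s w" "w = (1 / u$3) *s u"
        using False by (simp_all add: w_def v_def vec_eq_iff forall_3)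
      then have "u \<in> vec.span {w}" "w \<in> vec.span {u}"
        unfolding vec.span_singleton by blast+
      then have "vec.span {u} = vec.span {w}"
        by (intro subset_antisym vec.span_minimal) auto
      then have "P = hom_point (v$1) (v$2) 1"
        by (simp add: u hom_point_def w_def)
      then show ?thesis
        using P affine_part_iff[OF F] by blast
    qed
  qed
  have "CARD('a) + 1 = card (conic_of F)"
    using assms(2) by (simp add: oval_def)
  also have "\<dots> \<le> card ((\<lambda>v. hom_point (v$1) (v$2) 1) ` affine_part F \<union> {P \<in> conic_of F. P \<subseteq> l})"
    using cov by (intro card_mono) auto
  also have "\<dots> \<le> card ((\<lambda>v. hom_point (v$1) (v$2) 1) ` affine_part F) + card {P \<in> conic_of F. P \<subseteq> l}"
    by (rule card_Un_le)
  also have "\<dots> \<le> card (affine_part F) + 2"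
    using oval_line_card[OF assms(2) \<open>l \<in> pg_lines\<close>] by (intro add_mono card_image_le) auto
  finally show ?thesis
    by simp
qed

section \<open>Pencils of quadratic forms\<close>

lemma quadratic_form_pencil_member:
  assumes "quadratic_form \<phi>" "quadratic_form \<psi>"
  shows "quadratic_form (pencil_member \<phi> \<psi> \<alpha> \<beta>)"
proof -
  obtain a b c d e f where 1: "\<And>v. \<phi> v =
      a * (v$1)\<^sup>2 + b * (v$2)\<^sup>2 + c * (v$3)\<^sup>2 + d * v$1 * v$2 + e * v$1 * v$3 + f * v$2 * v$3"
    using assms(1) unfolding quadratic_form_def by blast
  obtain a' b' c' d' e' f' where 2: "\<And>v. \<psi> v =
      a' * (v$1)\<^sup>2 + b' * (v$2)\<^sup>2 + c' * (v$3)\<^sup>2 + d' * v$1 * v$2 + e' * v$1 * v$3 + f' * v$2 * v$3"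
    using assms(2) unfolding quadratic_form_def by blast
  show ?thesis
    unfolding quadratic_form_def pencil_member_def 1 2
    by (rule exI[of _ "\<alpha> * a + \<beta> * a'"], rule exI[of _ "\<alpha> * b + \<beta> * b'"],
        rule exI[of _ "\<alpha> * c + \<beta> * c'"], rule exI[of _ "\<alpha> * d + \<beta> * d'"],
        rule exI[of _ "\<alpha> * e + \<beta> * e'"], rule exI[of _ "\<alpha> * f + \<beta> * f'"])
      (simp add: algebra_simps)
qed

lemma pencil_member_swap: "pencil_member \<psi> \<phi> \<beta> \<alpha> = pencil_member \<phi> \<psi> \<alpha> \<beta>"
  by (simp add: pencil_member_def fun_eq_iff add.commute)

section \<open>Characteristic two\<close>

text \<open>The characteristic divides \<open>2 ^ n\<close>, so a power of 2 vanishes in the field,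
  and hence so does 2.\<close>

lemma two_power_card_imp_char_two:
  assumes "CARD('a::{field,finite}) = 2 ^ n"
  shows "(x :: 'a) + x = 0"
proof -
  have "of_nat (2 ^ n) = (0 :: 'a)"
    using CHAR_dvd_CARD[where 'a = 'a] assms by (simp only: of_nat_eq_0_iff_char_dvd)
  then have "(2 :: 'a) = 0"
    by simp
  then show ?thesis
    by (metis mult_2 mult_zero_left)
qed

text \<open>\<open>F0\<close> removes the \<open>z\<^sup>2\<close> term, squaring is additive, and
  the \<open>xz\<close> and \<open>yz\<close> terms are linear once \<open>z = 1\<close>. The
  witness is the coefficient of \<open>xy\<close>; its factor is the determinant of \<open>v\<close>
  and \<open>w\<close>, written without signs in characteristic two.\<close>

lemma affine_polarization:
  fixes F :: "'a::field ^ 3 \<Rightarrow> 'a"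
  assumes "quadratic_form F" and two: "\<And>x :: 'a. x + x = 0" and F0: "F (vector [0, 0, 1]) = 0"
  shows "\<exists>d. \<forall>v w :: 'a ^ 2. F (vector [(v + w)$1, (v + w)$2, 1]) =
    F (vector [v$1, v$2, 1]) + F (vector [w$1, w$2, 1]) + d * (v$1 * w$2 + v$2 * w$1)"
proof -
  obtain a b c d e f where F: "\<And>v. F v =
      a * (v$1)\<^sup>2 + b * (v$2)\<^sup>2 + c * (v$3)\<^sup>2 + d * v$1 * v$2 + e * v$1 * v$3 + f * v$2 * v$3"
    using assms(1) unfolding quadratic_form_def by blast
  have c: "c = 0"
    using F0 by (simp add: F)
  have sq: "(x + y)\<^sup>2 = x\<^sup>2 + y\<^sup>2" for x y :: 'a
    using two[of "x * y"] by (simp add: power2_eq_square algebra_simps)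
  show ?thesis
    by (rule exI[of _ d]) (simp add: F c sq algebra_simps)
qed

lemma affine_part_additive:
  fixes F :: "'a::{field,finite} ^ 3 \<Rightarrow> 'a" and v w :: "'a ^ 2"
  assumes F: "quadratic_form F" and C: "translation_oval (conic_of F)"
    and two: "\<And>x :: 'a. x + x = 0" and F0: "F (vector [0, 0, 1]) = 0"
    and q: "4 \<le> CARD('a)"
  shows "F (vector [(v + w)$1, (v + w)$2, 1]) = F (vector [v$1, v$2, 1]) + F (vector [w$1, w$2, 1])"
proof -
  obtain d where d: "\<And>v w :: 'a ^ 2. F (vector [(v + w)$1, (v + w)$2, 1]) =
    F (vector [v$1, v$2, 1]) + F (vector [w$1, w$2, 1]) + d * (v$1 * w$2 + v$2 * w$1)"
    using affine_polarization[OF F two F0] by metis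
  let ?S = "affine_part F"
  have oval: "oval (conic_of F)"
    using C by (simp add: translation_oval_def)
  have closed: "v + w \<in> ?S" if "v \<in> ?S" "w \<in> ?S" for v w
    using that C unfolding affine_part_iff[OF F] translation_oval_def by simp
  \<comment> \<open>There are at least \<open>q - 1\<close> affine points, so
    \<open>q \<ge> 4\<close> yields the third point that a line cannot hold.\<close>
  have card: "3 \<le> card ?S"
    using card_affine_part_ge[OF F oval] q by simp
  have "\<not> ?S \<subseteq> {0}"
  proof
    assume "?S \<subseteq> {0}"
    then have "card ?S \<le> 1"
      using card_mono[of "{0 :: 'a ^ 2}" ?S] by simp
    then show False
      using card by simp
  qed
  then obtain u where u: "u \<in> ?S" "u \<noteq> 0"
    by blast
  have "d = 0"
  proof (rule ccontr)
    assume "d \<noteq> 0"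
    \<comment> \<open>A nonzero \<open>d\<close> makes every \<open>w\<close> in \<open>?S\<close>
      proportional to the fixed \<open>u\<close>, because \<open>u + w\<close> is again in
      \<open>?S\<close>.\<close>
    have "w \<in> range (\<lambda>t. 0 + t *s u)" if w: "w \<in> ?S" for w
    proof -
      have "u$1 * w$2 + u$2 * w$1 = 0"
        using d[of u w] \<open>d \<noteq> 0\<close> u w closed[OF u(1) w] by (simp add: affine_part_def)
      then have "u$1 * w$2 = u$2 * w$1"
        using two[of "u$2 * w$1"] by (metis add_right_cancel)
      then have "w = 0 + (if u$1 = 0 then w$2 / u$2 else w$1 / u$1) *s u"
        using u by (auto simp: vec_eq_iff forall_2 field_simps)
      then show ?thesis
        by blast
    qed
    then have "?S \<inter> range (\<lambda>t. 0 + t *s u) = ?S"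
      by blast
    then have "card ?S \<le> 2"
      using card_affine_part_line[OF F oval u(2), of 0] by simp
    then show False
      using card by simp
  qed
  then show ?thesis
    using d by simp
qed

text \<open>The hypothesis on the pencil compares distinct point sets only, so the case that both
  generators define the same conic has to be excluded first.\<close>

lemma conics_meet_trivially:
  fixes \<phi> \<psi> :: "'a::{field,finite} ^ 3 \<Rightarrow> 'a"
  assumes \<phi>: "quadratic_form \<phi>" and \<psi>: "quadratic_form \<psi>"
    and pencil: "trivially_intersecting_conic_pencil \<phi> \<psi>"
  shows "conic_of \<phi> \<inter> conic_of \<psi> = {hom_point 0 0 1}"
proof -
  let ?h = "\<lambda>v :: 'a ^ 2. hom_point (v$1) (v$2) 1"
  have mem: "conic_of (pencil_member \<phi> \<psi> \<alpha> \<beta>) \<in> pencil_conics \<phi> \<psi>" if "(\<alpha>, \<beta>) \<noteq> (0, 0)" for \<alpha> \<beta>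
    using that unfolding pencil_conics_def by blast
  have oval: "oval (conic_of (pencil_member \<phi> \<psi> \<alpha> \<beta>))" if "(\<alpha>, \<beta>) \<noteq> (0, 0)" for \<alpha> \<beta>
    using mem[OF that] pencil
    unfolding trivially_intersecting_conic_pencil_def translation_oval_def by blast
  have p10: "pencil_member \<phi> \<psi> 1 0 = \<phi>" and p01: "pencil_member \<phi> \<psi> 0 1 = \<psi>"
    by (auto simp: pencil_member_def)
  have "conic_of \<phi> \<noteq> conic_of \<psi>"
  proof \<comment> \<open>otherwise the member through a further point has \<open>q + 2\<close> points\<close>
    assume eq: "conic_of \<phi> = conic_of \<psi>"
    have oval\<phi>: "oval (conic_of \<phi>)"
      using oval[of 1 0] by (simp add: p10)
    \<comment> \<open>There are \<open>q * q\<close> affine points, more than the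
      \<open>q + 1\<close> points of the conic, so some affine point lies off it.\<close>
    have "CARD('a) \<ge> 2"
      using card_mono[of UNIV "{0, 1 :: 'a}"] by simp
    then have "2 * CARD('a) \<le> CARD('a) * CARD('a)" "CARD('a) + 1 < 2 * CARD('a)"
      by simp_all
    then have "CARD('a) + 1 < CARD('a) * CARD('a)"
      by linarith
    then have "CARD('a) + 1 < CARD('a ^ 2)"
      by (simp add: power2_eq_square)
    then have "affine_part \<phi> \<noteq> UNIV"
      using card_affine_part_le[OF \<phi> oval\<phi>] by auto
    then obtain v :: "'a ^ 2" where v: "\<phi> (vector [v$1, v$2, 1]) \<noteq> 0"
      by (auto simp: affine_part_def)
    \<comment> \<open>These coefficients make the member vanish at \<open>v\<close>;
      \<open>\<beta> \<noteq> 0\<close> by the choice of \<open>v\<close>.\<close>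
    define \<alpha> where "\<alpha> = \<psi> (vector [v$1, v$2, 1])"
    define \<beta> where "\<beta> = - \<phi> (vector [v$1, v$2, 1])"
    define M where "M = pencil_member \<phi> \<psi> \<alpha> \<beta>"
    have M: "quadratic_form M" "oval (conic_of M)"
      using quadratic_form_pencil_member[OF \<phi> \<psi>] oval[of \<alpha> \<beta>] v by (auto simp: M_def \<beta>_def)
    have "v \<in> affine_part M"
      by (simp add: affine_part_def M_def pencil_member_def \<alpha>_def \<beta>_def)
    then have "?h v \<in> conic_of M"
      by (simp add: affine_part_iff[OF M(1)])
    moreover have "conic_of \<phi> \<subseteq> conic_of M"
    proof
      fix P assume "P \<in> conic_of \<phi>"
      moreover from this have "P \<in> conic_of \<psi>"
        using eq by simp
      ultimately show "P \<in> conic_of M"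
        by (simp add: conic_of_def M_def pencil_member_def)
    qed
    ultimately have "insert (?h v) (conic_of \<phi>) \<subseteq> conic_of M"
      by blast
    then have "card (insert (?h v) (conic_of \<phi>)) \<le> card (conic_of M)"
      by (intro card_mono) auto
    moreover have "?h v \<notin> conic_of \<phi>"
      using v affine_part_iff[OF \<phi>] by (auto simp: affine_part_def)
    ultimately show False
      using oval\<phi> M(2) by (simp add: oval_def)
  qed
  moreover have "conic_of \<phi> \<in> pencil_conics \<phi> \<psi>" "conic_of \<psi> \<in> pencil_conics \<phi> \<psi>"
    using mem[of 1 0] mem[of 0 1] by (simp_all add: p10 p01)
  ultimately have "trivially_intersecting (conic_of \<phi>) (conic_of \<psi>)"
    using pencil unfolding trivially_intersecting_conic_pencil_def by blast
  then show ?thesis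
    by (simp add: trivially_intersecting_def)
qed


section \<open>The field of two elements\<close>

lemma char_two_add_eq_0_iff:
  assumes "\<And>x :: 'a::ab_group_add. x + x = 0"
  shows "x + y = 0 \<longleftrightarrow> x = (y :: 'a)"
proof -
  have "- y = y"
    using assms[of y] by (simp add: neg_eq_iff_add_eq_0)
  then show ?thesis
    using eq_neg_iff_add_eq_0[of x y] by simp
qed

text \<open>Two distinct nonzero elements would yield the four affine points 0, \<open>v\<close>,
  \<open>w\<close>, \<open>v + w\<close>, but an oval over the field of two elements has only three
  points.\<close>

lemma affine_part_two_elements:
  fixes F :: "'a::{field,finite} ^ 3 \<Rightarrow> 'a"
  assumes q: "CARD('a) = 2" and F: "quadratic_form F" and C: "translation_oval (conic_of F)"
    and two: "\<And>x :: 'a. x + x = 0" and F0: "F (vector [0, 0, 1]) = 0"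
    and v: "v \<in> affine_part F" "v \<noteq> 0" and w: "w \<in> affine_part F" "w \<noteq> 0"
  shows "v = w"
proof (rule ccontr)
  assume "v \<noteq> w"
  have "0 \<in> affine_part F"
    using F0 by (simp add: affine_part_def)
  moreover have "v + w \<in> affine_part F"
    using v w C unfolding translation_oval_def affine_part_iff[OF F] by simp
  ultimately have "{0, v, w, v + w} \<subseteq> affine_part F"
    using v w by simp
  then have "card {0, v, w, v + w} \<le> card (affine_part F)"
    by (intro card_mono) auto
  also have "\<dots> \<le> 3"
    using card_affine_part_le[OF F] C q by (simp add: translation_oval_def)
  finally have "card {0, v, w, v + w} \<le> 3" .
  moreover have "v + w \<noteq> 0"
    using \<open>v \<noteq> w\<close> by (auto simp: vec_eq_iff char_two_add_eq_0_iff[OF two])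
  then have "card {0, v, w, v + w} = 4"
    using v w \<open>v \<noteq> w\<close> by auto
  ultimately show False
    by simp
qed

text \<open>The values of \<open>(\<phi>, \<psi>)\<close> at the three nonzero vectors turn out to
  be the three nonzero pairs in some order, so \<open>\<phi>\<close> takes the values 0, 1, 1 there,
  whose sum vanishes.\<close>

lemma pencil_additive_two_elements:
  fixes \<phi> \<psi> :: "'a::{field,finite} ^ 3 \<Rightarrow> 'a" and v w :: "'a ^ 2"
  assumes q: "CARD('a) = 2" and \<phi>: "quadratic_form \<phi>" and \<psi>: "quadratic_form \<psi>"
    and two: "\<And>x :: 'a. x + x = 0"
    and C: "\<And>\<alpha> \<beta>. (\<alpha>, \<beta>) \<noteq> (0, 0) \<Longrightarrow> translation_oval (conic_of (pencil_member \<phi> \<psi> \<alpha> \<beta>))"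
    and \<phi>0: "\<phi> (vector [0, 0, 1]) = 0" and \<psi>0: "\<psi> (vector [0, 0, 1]) = 0"
    and kernel: "affine_part \<phi> \<inter> affine_part \<psi> = {0}"
  shows "\<phi> (vector [(v + w)$1, (v + w)$2, 1]) = \<phi> (vector [v$1, v$2, 1]) + \<phi> (vector [w$1, w$2, 1])"
proof -
  let ?e = "vector [1, 0] :: 'a ^ 2" and ?f = "vector [0, 1] :: 'a ^ 2" and ?s = "vector [1, 1] :: 'a ^ 2"
  have vals: "x = 0 \<or> x = 1" for x :: 'a
  proof -
    have "{0, 1} = (UNIV :: 'a set)"
      using q by (intro card_subset_eq) auto
    then show ?thesis by blast
  qed
  have ne: "?e \<noteq> 0" "?f \<noteq> 0" "?s \<noteq> 0" "?e \<noteq> ?f" "?e \<noteq> ?s" "?f \<noteq> ?s"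
    by (auto simp: vec_eq_iff forall_2)
  have one: "\<not> (?e \<in> affine_part M \<and> ?f \<in> affine_part M)
      \<and> \<not> (?e \<in> affine_part M \<and> ?s \<in> affine_part M)
      \<and> \<not> (?f \<in> affine_part M \<and> ?s \<in> affine_part M)"
    if "M = pencil_member \<phi> \<psi> \<alpha> \<beta>" "(\<alpha>, \<beta>) \<noteq> (0, 0)" for M \<alpha> \<beta>
  proof -
    have "quadratic_form M"
      using that quadratic_form_pencil_member[OF \<phi> \<psi>] by simp
    moreover have "translation_oval (conic_of M)"
      using that C by simp
    moreover have "M (vector [0, 0, 1]) = 0"
      using that \<phi>0 \<psi>0 by (simp add: pencil_member_def)
    ultimately have "v = w" if "v \<in> affine_part M" "v \<noteq> 0" "w \<in> affine_part M" "w \<noteq> 0" for v w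
      using affine_part_two_elements[OF q _ _ two] that by blast
    then show ?thesis
      using ne by blast
  qed
  have nz: "\<not> (v \<in> affine_part \<phi> \<and> v \<in> affine_part \<psi>)" if "v \<noteq> 0" for v
    using that kernel by blast
  obtain a b c where \<phi>_vals: "a = \<phi> (vector [1, 0, 1])" "b = \<phi> (vector [0, 1, 1])" "c = \<phi> (vector [1, 1, 1])"
    by blast
  obtain a' b' c' where \<psi>_vals: "a' = \<psi> (vector [1, 0, 1])" "b' = \<psi> (vector [0, 1, 1])" "c' = \<psi> (vector [1, 1, 1])"
    by blast
  note vals_simps = affine_part_def pencil_member_def \<phi>_vals[symmetric] \<psi>_vals[symmetric]
  \<comment> \<open>The parameters (1 : 0), (0 : 1) and (1 : 1) exhaust the pencil.\<close>
  have "\<not> (a = 0 \<and> b = 0) \<and> \<not> (a = 0 \<and> c = 0) \<and> \<not> (b = 0 \<and> c = 0)"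
    using one[OF refl, of 1 0] by (simp add: vals_simps)
  moreover have "\<not> (a' = 0 \<and> b' = 0) \<and> \<not> (a' = 0 \<and> c' = 0) \<and> \<not> (b' = 0 \<and> c' = 0)"
    using one[OF refl, of 0 1] by (simp add: vals_simps)
  moreover have "\<not> (a + a' = 0 \<and> b + b' = 0) \<and> \<not> (a + a' = 0 \<and> c + c' = 0) \<and> \<not> (b + b' = 0 \<and> c + c' = 0)"
    using one[OF refl, of 1 1] by (simp add: vals_simps)
  moreover have "\<not> (a = 0 \<and> a' = 0)" "\<not> (b = 0 \<and> b' = 0)" "\<not> (c = 0 \<and> c' = 0)"
    using nz[of ?e] nz[of ?f] nz[of ?s] ne by (simp_all add: vals_simps)
  ultimately have sum: "c = a + b"
    using vals[of a] vals[of b] vals[of c] vals[of a'] vals[of b'] vals[of c'] two[of 1]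
    by (elim disjE) simp_all
  obtain d where d: "\<forall>v w :: 'a ^ 2. \<phi> (vector [(v + w)$1, (v + w)$2, 1]) =
      \<phi> (vector [v$1, v$2, 1]) + \<phi> (vector [w$1, w$2, 1]) + d * (v$1 * w$2 + v$2 * w$1)"
    using affine_polarization[OF \<phi> two \<phi>0] by blast
  \<comment> \<open>The sum of \<open>?e\<close> and \<open>?f\<close> is \<open>?s\<close> and
    their determinant is 1, so the polarization identity isolates \<open>d\<close>.\<close>
  have "d = 0"
    using d[rule_format, of ?e ?f] sum by (simp add: \<phi>_vals)
  then show ?thesis
    using d by simp
qed

section \<open>The line spread\<close>

lemma group_partition_line_spread:
  "group_partition CARD('a) (line_spread :: ('a::{field,finite} ^ 2) set set)"
proof
  show "2 \<le> CARD('a)"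
    using card_mono[of UNIV "{0, 1 :: 'a}"] by simp
  show "CARD('a ^ 2) = CARD('a) * CARD('a)"
    by (simp add: power2_eq_square)
  show "\<Union>(line_spread :: ('a ^ 2) set set) = UNIV"
  proof -
    have "w \<in> \<Union>line_spread" for w :: "'a ^ 2"
    proof (cases "w = 0")
      case True
      then have "w \<in> vec.span {vector [1, 0]}"
        by (simp add: vec.span_zero)
      moreover have "vector [1, 0] \<noteq> (0 :: 'a ^ 2)"
        by (auto simp: vec_eq_iff forall_2)
      ultimately show ?thesis
        unfolding line_spread_def using span_singleton_in_pg_points by blast
    next
      case False
      then show ?thesis
        unfolding line_spread_def using span_singleton_in_pg_points vec.span_base by blast
    qed
    then show ?thesis by blast
  qed
  fix A :: "('a ^ 2) set" assume A: "A \<in> line_spread"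
  then have sub: "vec.subspace A"
    by (simp add: line_spread_def pg_points_def)
  show "0 \<in> A"
    using sub by (rule vec.subspace_0)
  show "card A = CARD('a)"
    using A card_pg_point by (auto simp: line_spread_def)
  show "x - y \<in> A" if "x \<in> A" "y \<in> A" for x y
    using sub that by (rule vec.subspace_diff)
  \<comment> \<open>Any nonzero vector of a member spans it, so two members sharing one
    coincide.\<close>
  have span: "A = vec.span {x}" if A: "A \<in> line_spread" and x: "x \<in> A" "x \<noteq> 0" for A :: "('a ^ 2) set" and x
  proof -
    obtain u where u: "A = vec.span {u}"
      using A pg_pointE unfolding line_spread_def by blast
    then obtain k where k: "x = k *s u"
      using x by (auto simp: vec.span_singleton)
    then have "u = (1 / k) *s x"
      using x by (auto simp: vec_eq_iff)
    then have "u \<in> vec.span {x}"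
      unfolding vec.span_singleton by blast
    then show ?thesis
      using u x by (intro subset_antisym) (simp_all add: vec.span_minimal)
  qed
  fix B :: "('a ^ 2) set" assume B: "B \<in> line_spread" and "A \<noteq> B"
  then have "A \<inter> B \<subseteq> {0}"
    using span[OF A] span[OF B] by blast
  moreover have "0 \<in> B"
    using B by (simp add: line_spread_def pg_points_def vec.subspace_0)
  ultimately show "A \<inter> B = {0}"
    using \<open>0 \<in> A\<close> by blast
qed

theorem theorem3p8:
  fixes n :: nat and \<phi> \<psi> :: "'a::{field,finite} ^ 3 \<Rightarrow> 'a"
  assumes "n \<ge> 1" and "CARD('a) = 2 ^ n"
    and "quadratic_form \<phi>" and "quadratic_form \<psi>"
    and "trivially_intersecting_conic_pencil \<phi> \<psi>"
  shows "is_spread n (affine_parts \<phi> \<psi>) \<and>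
    desarguesian (translation_plane (affine_parts \<phi> \<psi>)) \<and>
    orthogoval UNIV (translation_plane (affine_parts \<phi> \<psi>))
      (translation_plane (line_spread :: ('a ^ 2) set set))"
proof -
  have two: "x + x = 0" for x :: 'a
    using two_power_card_imp_char_two[OF assms(2)] .
  have C: "translation_oval (conic_of (pencil_member \<phi> \<psi> \<alpha> \<beta>))" if "(\<alpha>, \<beta>) \<noteq> (0, 0)" for \<alpha> \<beta>
    using assms(5) that unfolding trivially_intersecting_conic_pencil_def pencil_conics_def by blast
  have "pencil_member \<phi> \<psi> 1 0 = \<phi>" "pencil_member \<phi> \<psi> 0 1 = \<psi>"
    by (auto simp: pencil_member_def)
  then have C10: "translation_oval (conic_of \<phi>)" and C01: "translation_oval (conic_of \<psi>)"
    using C[of 1 0] C[of 0 1] by simp_all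
  have meet: "conic_of \<phi> \<inter> conic_of \<psi> = {hom_point 0 0 1}"
    using assms(3-5) by (rule conics_meet_trivially)
  \<comment> \<open>The common point (0 : 0 : 1) is the affine origin, so both forms lack a
    \<open>z\<^sup>2\<close> term.\<close>
  then have \<phi>0: "\<phi> (vector [0, 0, 1]) = 0" and \<psi>0: "\<psi> (vector [0, 0, 1]) = 0"
    using hom_point_in_conic_iff[OF assms(3), of 1 0 0] hom_point_in_conic_iff[OF assms(4), of 1 0 0]
    by auto
  have "v = 0" if "v \<in> affine_part \<phi> \<inter> affine_part \<psi>" for v
  proof -
    have "hom_point (v$1) (v$2) 1 = hom_point ((0 :: 'a ^ 2)$1) ((0 :: 'a ^ 2)$2) 1"
      using that meet affine_part_iff[OF assms(3)] affine_part_iff[OF assms(4)] by auto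
    then show ?thesis
      by (rule injD[OF inj_hom_point_affine])
  qed
  then have kernel: "affine_part \<phi> \<inter> affine_part \<psi> = {0}"
    using \<phi>0 \<psi>0 by (auto simp: affine_part_def)
  have additive: "\<phi> (vector [(v + w)$1, (v + w)$2, 1]) = \<phi> (vector [v$1, v$2, 1]) + \<phi> (vector [w$1, w$2, 1]) \<and>
      \<psi> (vector [(v + w)$1, (v + w)$2, 1]) = \<psi> (vector [v$1, v$2, 1]) + \<psi> (vector [w$1, w$2, 1])"
    for v w :: "'a ^ 2"
  proof (cases "n = 1")
    case True
    then have q: "CARD('a) = 2"
      using assms(2) by simp
    \<comment> \<open>\<open>pencil_additive_two_elements\<close> concludes about its first form
      only; exchanging the roles reaches \<open>\<psi>\<close>.\<close>
    have C': "translation_oval (conic_of (pencil_member \<psi> \<phi> \<alpha> \<beta>))" if "(\<alpha>, \<beta>) \<noteq> (0, 0)" for \<alpha> \<beta>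
      using C[of \<beta> \<alpha>] that by (subst pencil_member_swap) blast
    have kernel': "affine_part \<psi> \<inter> affine_part \<phi> = {0}"
      using kernel by blast
    show ?thesis
      using pencil_additive_two_elements[OF q assms(3,4) two C \<phi>0 \<psi>0 kernel]
        pencil_additive_two_elements[OF q assms(4,3) two C' \<psi>0 \<phi>0 kernel'] by blast
  next
    case False
    then have "2 ^ 2 \<le> (2 :: nat) ^ n"
      using assms(1) by (intro power_increasing) auto
    then have q: "4 \<le> CARD('a)"
      using assms(2) by simp
    show ?thesis
      using affine_part_additive[OF assms(3) C10 two \<phi>0 q]
        affine_part_additive[OF assms(4) C01 two \<psi>0 q] by blast
  qed
  define g :: "'a ^ 2 \<Rightarrow> 'a ^ 2"
    where "g v = vector [\<phi> (vector [v$1, v$2, 1]), \<psi> (vector [v$1, v$2, 1])]" for v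
  have g_add: "g (v + w) = g v + g w" for v w
    using additive[of v w] by (simp add: g_def vec_eq_iff forall_2)
  \<comment> \<open>Additivity reduces injectivity to the trivial kernel; finiteness then gives
    surjectivity.\<close>
  have "inj g"
  proof (rule injI)
    fix v w assume "g v = g w"
    moreover have "g (v - w) + g w = g v"
      using g_add[of "v - w" w] by simp
    ultimately have "g (v - w) = 0"
      by simp
    then have "v - w \<in> affine_part \<phi> \<inter> affine_part \<psi>"
      by (simp add: g_def affine_part_def vec_eq_iff forall_2)
    then show "v = w"
      using kernel by simp
  qed
  then have "bij g"
    by (simp add: bij_def finite_UNIV_inj_surj)
  have parts: "affine_parts \<phi> \<psi> = (\<lambda>A. g -` A) ` line_spread"
  proof -
    have "affine_part (pencil_member \<phi> \<psi> \<alpha> \<beta>) = g -` {w. \<alpha> * w$1 + \<beta> * w$2 = 0}" for \<alpha> \<beta>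
      by (auto simp: affine_part_def pencil_member_def g_def)
    then show ?thesis
      unfolding affine_parts_def line_spread_eq by blast
  qed
  interpret lines: group_partition "CARD('a)" "line_spread :: ('a ^ 2) set set"
    by (rule group_partition_line_spread)
  interpret parts: group_partition "CARD('a)" "affine_parts \<phi> \<psi>"
    unfolding parts using g_add \<open>bij g\<close> by (rule lines.group_partition_vimage)
  have "is_spread n (affine_parts \<phi> \<psi>)"
    using two assms(2) by (intro parts.is_spread) (simp_all add: vec_eq_iff)
  moreover have "desarguesian (translation_plane (affine_parts \<phi> \<psi>))"
    unfolding desarguesian_def plane_isomorphic_def
  proof (intro exI conjI)
    \<comment> \<open>\<open>g\<close> is itself the isomorphism, since an additive bijection sends
      cosets to cosets.\<close>
    show "bij g"
      by (rule \<open>bij g\<close>)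
    have coset: "g ` (+) v ` (g -` A) = (+) (g v) ` A" for v A
    proof -
      have "g ` (+) v ` (g -` A) = (+) (g v) ` g ` (g -` A)"
        by (simp only: image_image g_add)
      then show ?thesis
        using \<open>bij g\<close> by (simp add: surj_image_vimage_eq bij_is_surj)
    qed
    show "(\<lambda>l. g ` l) ` translation_plane (affine_parts \<phi> \<psi>) = translation_plane line_spread"
    proof (intro equalityI subsetI)
      fix m assume "m \<in> (\<lambda>l. g ` l) ` translation_plane (affine_parts \<phi> \<psi>)"
      then obtain v A where "A \<in> line_spread" "m = g ` (+) v ` (g -` A)"
        unfolding translation_plane_def parts by auto
      then show "m \<in> translation_plane line_spread"
        using coset unfolding translation_plane_def by auto
    next
      fix m assume "m \<in> translation_plane (line_spread :: ('a ^ 2) set set)"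
      then obtain w A where A: "A \<in> line_spread" "m = (+) w ` A"
        unfolding translation_plane_def by blast
      obtain v where "w = g v"
        using surjD[OF bij_is_surj[OF \<open>bij g\<close>], of w] by blast
      then have "m = g ` (+) v ` (g -` A)"
        using A coset by simp
      then show "m \<in> (\<lambda>l. g ` l) ` translation_plane (affine_parts \<phi> \<psi>)"
        unfolding translation_plane_def parts using A(1) by auto
    qed
  qed
  moreover have "card (l \<inter> m) \<le> 2"
    if l: "l \<in> translation_plane (affine_parts \<phi> \<psi>)"
      and m: "m \<in> translation_plane (line_spread :: ('a ^ 2) set set)" for l m
  proof -
    obtain v \<alpha> \<beta> where ab: "(\<alpha>, \<beta>) \<noteq> (0, 0)"
      and l: "l = (+) v ` affine_part (pencil_member \<phi> \<psi> \<alpha> \<beta>)"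
      using l unfolding translation_plane_def affine_parts_def by auto
    let ?M = "pencil_member \<phi> \<psi> \<alpha> \<beta>"
    obtain w A where A: "A \<in> line_spread" "m = (+) w ` A"
      using m unfolding translation_plane_def by blast
    obtain d where d: "d \<noteq> 0" "A = vec.span {d}"
      using A(1) unfolding line_spread_def by (rule pg_pointE)
    then have m: "m = (+) w ` range (\<lambda>t. t *s d)"
      using A(2) by (simp only: vec.span_singleton)
    \<comment> \<open>Undoing the translation by \<open>v\<close> turns \<open>l\<close> into the
      affine part itself and only moves the base point of the affine line, to
      \<open>w - v\<close>.\<close>
    have "m = (+) v ` range (\<lambda>t. (w - v) + t *s d)"
      by (simp add: m image_image)
    then have "l \<inter> m = (+) v ` (affine_part ?M \<inter> range (\<lambda>t. (w - v) + t *s d))"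
      by (simp add: l image_Int)
    then have "card (l \<inter> m) = card (affine_part ?M \<inter> range (\<lambda>t. (w - v) + t *s d))"
      by (simp add: card_image)
    also have "\<dots> \<le> 2"
      using quadratic_form_pencil_member[OF assms(3,4)] C[OF ab] d
      by (intro card_affine_part_line) (simp_all add: translation_oval_def)
    finally show ?thesis .
  qed
  ultimately show ?thesis
    unfolding orthogoval_def using lines.affine_plane parts.affine_plane by (intro conjI) auto
qed

end
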